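(* Consider estimation of the functional $\theta\mapsto\|\theta\|_2^2$ in the Gaussian sequence model $X_i\sim\mathcal N(\theta_i,1)$, $i=1,\dots,n$, independent, with sparsity $s=s_n$ and parameter space $$\Theta_n^2(s):=\Theta(s)\cap\Big\{\theta:\sum_{i=1}^n\theta_i^2\le 2s\log\Big(1+\frac{\sqrt n}{s}\Big)\Big\}.$$ (i) If $s\ll\sqrt n$, then the minimax estimation rate is $s^2\log^2(n/s^2)$, and any estimator $\widehat{\|\theta\|_2^2}$ attaining the minimax optimal estimation rate must satisfy, for all sufficiently large $n$, $$\sup_{\theta\in\Theta_n^2(s)}\Big(E_\theta\big[\widehat{\|\theta\|_2^2}\big]-\|\theta\|_2^2\Big)^2\asymp s^2\log^2\Big(\frac n{s^2}\Big).$$ Moreover, if $s\le n^{1/2-\delta}$ for some $0<\delta<1/2$, then there exists a minimax rate optimal estimator $\widehat{\|\theta\|_2^2}$ with $\sup_{\theta\in\Theta_n^2(s)}\mathrm{Var}_\theta\big(\widehat{\|\theta\|_2^2}\big)\lesssim s\log(n/s^2)$. (ii) If $s\gtrsim\sqrt n$, then there exists a minimax rate optimal estimator that is unbiased.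
   Context: $\Theta(s)$ is the set of all vectors $\theta\in\mathbb R^n$ with at most $s$ non-zero components, where $1\le s=s_n\le n$ is a sequence of integers; $s\ll\sqrt n$ means $s_n/\sqrt n\to0$. "Estimator" means a sequence (in $n$) of real-valued measurable functions $\widehat{\|\theta\|_2^2}$ of $X=(X_1,\dots,X_n)$ with finite expectation for all parameters. The minimax estimation rate is the order (up to multiplicative constants, as $n\to\infty$) of $\inf\sup_{\theta\in\Theta_n^2(s)}E_\theta[(\widehat{\|\theta\|_2^2}-\|\theta\|_2^2)^2]$, the infimum being over all estimators; an estimator attains the minimax rate (is minimax rate optimal) if its worst-case mean squared error $\sup_{\theta\in\Theta_n^2(s)}E_\theta[(\widehat{\|\theta\|_2^2}-\|\theta\|_2^2)^2]$ is, up to a multiplicative constant not depending on $n$, bounded by the minimax rate for all sufficiently large $n$. $a_n\lesssim b_n$ (equivalently $b_n\gtrsim a_n$) means $a_n\le Cb_n$ for a constant $C$ and all sufficiently large $n$; $a_n\asymp b_n$ means $a_n\lesssim b_n$ and $b_n\lesssim a_n$. *)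

theory Defs
  imports "HOL-Probability.Probability"
begin

text \<open>Vectors of length \<open>n\<close> are the functions in \<open>{1..n} \<rightarrow>\<^sub>E UNIV\<close>, so that \<open>n\<close> can vary.\<close>

definition sq_norm :: "nat \<Rightarrow> (nat \<Rightarrow> real) \<Rightarrow> real" where
  "sq_norm n \<theta> = (\<Sum>i=1..n. (\<theta> i)\<^sup>2)"

definition sparse_vectors :: "nat \<Rightarrow> nat \<Rightarrow> (nat \<Rightarrow> real) set" where
  "sparse_vectors n s = {\<theta> \<in> {1..n} \<rightarrow>\<^sub>E UNIV. card {i \<in> {1..n}. \<theta> i \<noteq> 0} \<le> s}"

definition param_space :: "nat \<Rightarrow> nat \<Rightarrow> (nat \<Rightarrow> real) set" where
  "param_space n s =
     sparse_vectors n s \<inter> {\<theta>. sq_norm n \<theta> \<le> 2 * real s * ln (1 + sqrt (real n) / real s)}"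

text \<open>The joint law of independent \<open>X\<^sub>i\<close> with distribution \<open>N(\<theta>\<^sub>i, 1)\<close>.\<close>

definition gauss_model :: "nat \<Rightarrow> (nat \<Rightarrow> real) \<Rightarrow> (nat \<Rightarrow> real) measure" where
  "gauss_model n \<theta> =
     (\<Pi>\<^sub>M i\<in>{1..n}. density lborel (\<lambda>x. ennreal (normal_density (\<theta> i) 1 x)))"

definition estimators :: "nat \<Rightarrow> nat \<Rightarrow> ((nat \<Rightarrow> real) \<Rightarrow> real) set" where
  "estimators n s =
     {T \<in> borel_measurable (\<Pi>\<^sub>M i\<in>{1..n}. borel).
        \<forall>\<theta>\<in>param_space n s. integrable (gauss_model n \<theta>) T}"

text \<open>
  An estimator need not have a finite second moment. Risk and variance are therefore
  nonnegative integrals with values in \<^typ>\<open>ennreal\<close>: a Bochner integral would be 0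
  instead of infinite.
\<close>

definition mse :: "nat \<Rightarrow> ((nat \<Rightarrow> real) \<Rightarrow> real) \<Rightarrow> (nat \<Rightarrow> real) \<Rightarrow> ennreal" where
  "mse n T \<theta> = (\<integral>\<^sup>+ x. ennreal ((T x - sq_norm n \<theta>)\<^sup>2) \<partial>gauss_model n \<theta>)"

definition mean :: "nat \<Rightarrow> ((nat \<Rightarrow> real) \<Rightarrow> real) \<Rightarrow> (nat \<Rightarrow> real) \<Rightarrow> real" where
  "mean n T \<theta> = (\<integral>x. T x \<partial>gauss_model n \<theta>)"

definition vari :: "nat \<Rightarrow> ((nat \<Rightarrow> real) \<Rightarrow> real) \<Rightarrow> (nat \<Rightarrow> real) \<Rightarrow> ennreal" where
  "vari n T \<theta> = (\<integral>\<^sup>+ x. ennreal ((T x - mean n T \<theta>)\<^sup>2) \<partial>gauss_model n \<theta>)"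

definition worst_mse :: "nat \<Rightarrow> nat \<Rightarrow> ((nat \<Rightarrow> real) \<Rightarrow> real) \<Rightarrow> ennreal" where
  "worst_mse n s T = (SUP \<theta>\<in>param_space n s. mse n T \<theta>)"

definition worst_sq_bias :: "nat \<Rightarrow> nat \<Rightarrow> ((nat \<Rightarrow> real) \<Rightarrow> real) \<Rightarrow> ennreal" where
  "worst_sq_bias n s T = (SUP \<theta>\<in>param_space n s. ennreal ((mean n T \<theta> - sq_norm n \<theta>)\<^sup>2))"

definition worst_var :: "nat \<Rightarrow> nat \<Rightarrow> ((nat \<Rightarrow> real) \<Rightarrow> real) \<Rightarrow> ennreal" where
  "worst_var n s T = (SUP \<theta>\<in>param_space n s. vari n T \<theta>)"

definition minimax_risk :: "nat \<Rightarrow> nat \<Rightarrow> ennreal" where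
  "minimax_risk n s = (INF T\<in>estimators n s. worst_mse n s T)"

definition lesssim :: "(nat \<Rightarrow> ennreal) \<Rightarrow> (nat \<Rightarrow> ennreal) \<Rightarrow> bool" where
  "lesssim a b \<longleftrightarrow> (\<exists>C::real. C > 0 \<and> (\<forall>\<^sub>F n in sequentially. a n \<le> ennreal C * b n))"

definition same_order :: "(nat \<Rightarrow> ennreal) \<Rightarrow> (nat \<Rightarrow> ennreal) \<Rightarrow> bool" where
  "same_order a b \<longleftrightarrow> lesssim a b \<and> lesssim b a"

definition estimator_seq :: "(nat \<Rightarrow> nat) \<Rightarrow> (nat \<Rightarrow> (nat \<Rightarrow> real) \<Rightarrow> real) \<Rightarrow> bool" where
  "estimator_seq s T \<longleftrightarrow> (\<forall>n\<ge>1. T n \<in> estimators n (s n))"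

definition rate_optimal :: "(nat \<Rightarrow> nat) \<Rightarrow> (nat \<Rightarrow> (nat \<Rightarrow> real) \<Rightarrow> real) \<Rightarrow> bool" where
  "rate_optimal s T \<longleftrightarrow>
     estimator_seq s T \<and> lesssim (\<lambda>n. worst_mse n (s n) (T n)) (\<lambda>n. minimax_risk n (s n))"

definition unbiased :: "(nat \<Rightarrow> nat) \<Rightarrow> (nat \<Rightarrow> (nat \<Rightarrow> real) \<Rightarrow> real) \<Rightarrow> bool" where
  "unbiased s T \<longleftrightarrow> (\<forall>n\<ge>1. \<forall>\<theta>\<in>param_space n (s n). mean n (T n) \<theta> = sq_norm n \<theta>)"

end

theory Submission
  imports Defs
begin

text \<open>
  If \<open>s \<ll> sqrt n\<close>, the constant estimator 0 has variance 0 and worst-case risk at most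
  \<open>4 s\<^sup>2 ln\<^sup>2 (n/s\<^sup>2)\<close>. For the lower bounds, split the coordinates into \<open>s\<close> blocks of length
  \<open>k = n div s\<close> and put one spike of height \<open>\<rho>\<close> at a uniformly random place of each block. The
  chi-square divergence of this mixture from the law at \<open>\<theta> = 0\<close> is at most
  \<open>exp (s (exp \<rho>\<^sup>2 - 1) / k) - 1\<close>. By Cauchy-Schwarz, the mean of an estimator changes between
  the mixture and \<open>\<theta> = 0\<close> by at most the root of (risk at 0 times divergence), whereas the
  functional changes by \<open>s \<rho>\<^sup>2\<close>; the rest must be bias. With \<open>exp \<rho>\<^sup>2 = sqrt n/s\<close> the
  divergence tends to 0, so the bias itself is of the order of the rate.

  If \<open>s \<ge> c sqrt n\<close>, the same prior with \<open>\<rho> = 1\<close> and about \<open>sqrt n\<close> spikes gives the lower bound \<open>n\<close>,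
  which \<open>\<Sum>\<^sub>i (X\<^sub>i\<^sup>2 - 1)\<close> attains.
\<close>

section \<open>Cauchy-Schwarz and Gaussian likelihood ratios\<close>

text \<open>Transfers \<open>Cauchy_Schwarz_nn_integral\<close> to Bochner integrals; square
  integrability keeps all the integrals finite. It serves to bound the shift of a mean between two
  laws and, with \<open>g = 1\<close>, the squared bias by the risk.\<close>

lemma integral_Cauchy_Schwarz:
  fixes f g :: "'a \<Rightarrow> real"
  assumes [measurable]: "f \<in> borel_measurable M" "g \<in> borel_measurable M"
    and f2: "integrable M (\<lambda>x. (f x)\<^sup>2)" and g2: "integrable M (\<lambda>x. (g x)\<^sup>2)"
  shows "\<bar>\<integral>x. f x * g x \<partial>M\<bar> \<le> sqrt ((\<integral>x. (f x)\<^sup>2 \<partial>M) * (\<integral>x. (g x)\<^sup>2 \<partial>M))"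
proof -
  have fg: "integrable M (\<lambda>x. f x * g x)"
  proof (rule Bochner_Integration.integrable_bound[OF Bochner_Integration.integrable_add[OF f2 g2]])
    show "AE x in M. norm (f x * g x) \<le> norm ((f x)\<^sup>2 + (g x)\<^sup>2)"
    proof (rule AE_I2)
      fix x
      show "norm (f x * g x) \<le> norm ((f x)\<^sup>2 + (g x)\<^sup>2)"
        using sum_squares_bound[of "\<bar>f x\<bar>" "\<bar>g x\<bar>"] abs_ge_zero[of "f x * g x"]
        unfolding real_norm_def abs_mult mult.assoc power2_abs by linarith
    qed
  qed measurable
  have "ennreal ((\<integral>x. \<bar>f x * g x\<bar> \<partial>M)\<^sup>2) = (\<integral>\<^sup>+x. ennreal \<bar>f x\<bar> * ennreal \<bar>g x\<bar> \<partial>M)\<^sup>2"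
  proof -
    have "(\<integral>\<^sup>+x. ennreal \<bar>f x * g x\<bar> \<partial>M) = ennreal (\<integral>x. \<bar>f x * g x\<bar> \<partial>M)"
      using fg by (intro nn_integral_eq_integral) auto
    then show ?thesis
      by (simp add: ennreal_power abs_mult flip: ennreal_mult)
  qed
  also have "\<dots> \<le> (\<integral>\<^sup>+x. (ennreal \<bar>f x\<bar>)\<^sup>2 \<partial>M) * (\<integral>\<^sup>+x. (ennreal \<bar>g x\<bar>)\<^sup>2 \<partial>M)"
    by (rule Cauchy_Schwarz_nn_integral) measurable
  also have "\<dots> = ennreal ((\<integral>x. (f x)\<^sup>2 \<partial>M) * (\<integral>x. (g x)\<^sup>2 \<partial>M))"
    using f2 g2 by (simp add: nn_integral_eq_integral ennreal_power flip: ennreal_mult)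
  finally have "(\<integral>x. \<bar>f x * g x\<bar> \<partial>M)\<^sup>2 \<le> (\<integral>x. (f x)\<^sup>2 \<partial>M) * (\<integral>x. (g x)\<^sup>2 \<partial>M)"
    by (simp add: ennreal_le_iff)
  then have "(\<integral>x. \<bar>f x * g x\<bar> \<partial>M) \<le> sqrt ((\<integral>x. (f x)\<^sup>2 \<partial>M) * (\<integral>x. (g x)\<^sup>2 \<partial>M))"
    by (rule real_le_rsqrt)
  moreover have "\<bar>\<integral>x. f x * g x \<partial>M\<bar> \<le> (\<integral>x. \<bar>f x * g x\<bar> \<partial>M)"
    by (rule integral_abs_bound)
  ultimately show ?thesis by linarith
qed

abbreviation normal_law :: "real \<Rightarrow> real measure" where
  "normal_law \<mu> \<equiv> density lborel (\<lambda>x. ennreal (normal_density \<mu> 1 x))"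

lemma prob_space_normal_law: "prob_space (normal_law \<mu>)"
  by (rule prob_space_normal_density) simp

lemma product_prob_space_normal_law: "product_prob_space (\<lambda>i. normal_law (\<theta> i))"
  by (simp add: prob_space_normal_law product_prob_spaceI)

lemma sets_gauss_model [measurable_cong]: "sets (gauss_model n \<theta>) = sets (\<Pi>\<^sub>M i\<in>{1..n}. borel)"
  unfolding gauss_model_def by (intro sets_PiM_cong) auto

lemma prob_space_gauss_model: "prob_space (gauss_model n \<theta>)"
  unfolding gauss_model_def by (intro prob_space_PiM prob_space_normal_law)

text \<open>The density of the law at \<theta> relative to the law at 0: the product of the ratios
  of the one-dimensional normal densities.\<close>

definition gauss_likelihood :: "nat \<Rightarrow> (nat \<Rightarrow> real) \<Rightarrow> (nat \<Rightarrow> real) \<Rightarrow> real" where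
  "gauss_likelihood n \<theta> x = (\<Prod>i\<in>{1..n}. exp (\<theta> i * x i - (\<theta> i)\<^sup>2 / 2))"

lemma gauss_likelihood_nonneg [simp]: "0 \<le> gauss_likelihood n \<theta> x"
  by (simp add: gauss_likelihood_def prod_nonneg)

lemma measurable_gauss_likelihood [measurable]:
  "gauss_likelihood n \<theta> \<in> borel_measurable (\<Pi>\<^sub>M i\<in>{1..n}. borel)"
  unfolding gauss_likelihood_def by measurable

text \<open>Completing the square in each coordinate. As every likelihood has integral 1 under the
  law at 0, the product of two of them integrates to \<open>exp\<close> of the inner product of the
  parameters.\<close>

lemma gauss_likelihood_mult:
  "gauss_likelihood n \<theta> x * gauss_likelihood n \<eta> x =
     exp (\<Sum>i=1..n. \<theta> i * \<eta> i) * gauss_likelihood n (\<lambda>i. \<theta> i + \<eta> i) x"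
proof -
  have "exp (\<theta> i * x i - (\<theta> i)\<^sup>2 / 2) * exp (\<eta> i * x i - (\<eta> i)\<^sup>2 / 2) =
    exp (\<theta> i * \<eta> i) * exp ((\<theta> i + \<eta> i) * x i - (\<theta> i + \<eta> i)\<^sup>2 / 2)" for i
    unfolding exp_add[symmetric] by (simp add: power2_eq_square field_simps)
  then show ?thesis
    by (simp add: gauss_likelihood_def exp_sum flip: prod.distrib)
qed

lemma emeasure_normal_law:
  "emeasure (normal_law \<mu>) A =
     (\<integral>\<^sup>+x. ennreal (exp (\<mu> * x - \<mu>\<^sup>2 / 2)) * indicator A x \<partial>normal_law 0)"
  if [measurable]: "A \<in> sets borel"
proof -
  have "normal_density \<mu> 1 x = normal_density 0 1 x * exp (\<mu> * x - \<mu>\<^sup>2 / 2)" for x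
    unfolding normal_density_def
    by (simp add: power2_eq_square field_simps flip: exp_add)
  then show ?thesis
    by (subst nn_integral_density) (auto simp: emeasure_density ennreal_mult' mult_ac intro!: nn_integral_cong)
qed

text \<open>A measure with the right values on all boxes is the product measure. On a box the
  likelihood factors over the coordinates, and each factor is the one-dimensional change of
  density.\<close>

lemma gauss_model_eq_density:
  "gauss_model n \<theta> = density (gauss_model n (\<lambda>_. 0)) (\<lambda>x. ennreal (gauss_likelihood n \<theta> x))"
proof -
  interpret P: product_prob_space "\<lambda>i. normal_law (\<theta> i)"
    by (rule product_prob_space_normal_law)
  interpret Z: product_prob_space "\<lambda>i::nat. normal_law 0"
    by (rule product_prob_space_normal_law)
  let ?Z = "gauss_model n (\<lambda>_. 0)"
  have "density ?Z (\<lambda>x. ennreal (gauss_likelihood n \<theta> x)) = Pi\<^sub>M {1..n} (\<lambda>i. normal_law (\<theta> i))"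
  proof (rule P.PiM_eqI)
    show "sets (density ?Z (\<lambda>x. ennreal (gauss_likelihood n \<theta> x))) =
        sets (Pi\<^sub>M {1..n} (\<lambda>i. normal_law (\<theta> i)))"
      unfolding gauss_model_def by (auto intro!: sets_PiM_cong)
    fix A assume A: "\<And>i. i \<in> {1..n} \<Longrightarrow> A i \<in> sets (normal_law (\<theta> i))"
    then have A' [measurable]: "\<And>i. i \<in> {1..n} \<Longrightarrow> A i \<in> sets borel"
      by simp
    have [measurable]: "Pi\<^sub>E {1..n} A \<in> sets ?Z"
      unfolding gauss_model_def using A by (intro sets_PiM_I_finite) auto
    have "emeasure (density ?Z (\<lambda>x. ennreal (gauss_likelihood n \<theta> x))) (Pi\<^sub>E {1..n} A) =
        (\<integral>\<^sup>+x. ennreal (gauss_likelihood n \<theta> x) * indicator (Pi\<^sub>E {1..n} A) x \<partial>?Z)"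
      by (rule emeasure_density) measurable
    also have "\<dots> = (\<integral>\<^sup>+x. (\<Prod>i\<in>{1..n}. ennreal (exp (\<theta> i * x i - (\<theta> i)\<^sup>2 / 2)) * indicator (A i) (x i)) \<partial>?Z)"
    proof (rule nn_integral_cong)
      fix x assume "x \<in> space ?Z"
      \<comment> \<open>Points of the space are extensional, so the coordinates in
        \<open>{1..n}\<close> alone decide membership in the box and its indicator factors.\<close>
      then have "x \<in> extensional {1..n}"
        by (auto simp: gauss_model_def space_PiM PiE_def)
      then have "(indicator (Pi\<^sub>E {1..n} A) x :: ennreal) = (\<Prod>i\<in>{1..n}. indicator (A i) (x i))"
        by (auto simp: indicator_def PiE_iff prod_eq_1_iff intro!: prod_zero[symmetric])
      then show "ennreal (gauss_likelihood n \<theta> x) * indicator (Pi\<^sub>E {1..n} A) x =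
          (\<Prod>i\<in>{1..n}. ennreal (exp (\<theta> i * x i - (\<theta> i)\<^sup>2 / 2)) * indicator (A i) (x i))"
        by (simp add: gauss_likelihood_def prod.distrib prod_ennreal)
    qed
    also have "\<dots> = (\<Prod>i\<in>{1..n}. \<integral>\<^sup>+x. ennreal (exp (\<theta> i * x - (\<theta> i)\<^sup>2 / 2)) * indicator (A i) x \<partial>normal_law 0)"
      unfolding gauss_model_def by (rule Z.product_nn_integral_prod) (use A' in auto)
    also have "\<dots> = (\<Prod>i\<in>{1..n}. emeasure (normal_law (\<theta> i)) (A i))"
      using A' by (intro prod.cong refl emeasure_normal_law[symmetric]) auto
    finally show "emeasure (density ?Z (\<lambda>x. ennreal (gauss_likelihood n \<theta> x))) (Pi\<^sub>E {1..n} A) =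
        (\<Prod>i\<in>{1..n}. emeasure (normal_law (\<theta> i)) (A i))" .
  qed simp
  then show ?thesis
    by (simp add: gauss_model_def)
qed

lemma has_bochner_integral_gauss_likelihood:
  "has_bochner_integral (gauss_model n (\<lambda>_. 0)) (gauss_likelihood n \<theta>) 1"
proof -
  interpret prob_space "gauss_model n \<theta>"
    by (rule prob_space_gauss_model)
  have "(\<integral>\<^sup>+x. ennreal (gauss_likelihood n \<theta> x) \<partial>gauss_model n (\<lambda>_. 0)) = emeasure (gauss_model n \<theta>) (space (gauss_model n \<theta>))"
    by (subst (2) gauss_model_eq_density, subst emeasure_density)
       (measurable, auto intro!: nn_integral_cong simp: gauss_model_def space_PiM)
  also have "\<dots> = ennreal 1"
    by (simp add: emeasure_space_1)
  finally show ?thesis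
    by (intro has_bochner_integral_nn_integral AE_I2) auto
qed

text \<open>The second factor under the root is the chi-square divergence of the mixture from the law of \<open>\<theta> = 0\<close>.\<close>

lemma mixture_mean_diff_le:
  fixes \<Theta> :: "'a \<Rightarrow> nat \<Rightarrow> real"
  assumes T: "T \<in> borel_measurable (\<Pi>\<^sub>M i\<in>{1..n}. borel)"
    and T2: "integrable (gauss_model n (\<lambda>_. 0)) (\<lambda>x. (T x)\<^sup>2)"
    and TF: "\<And>f. f \<in> F \<Longrightarrow> integrable (gauss_model n (\<Theta> f)) T"
    and F: "finite F" "F \<noteq> {}"
  shows "\<bar>(\<Sum>f\<in>F. mean n T (\<Theta> f)) / card F - mean n T (\<lambda>_. 0)\<bar> \<le>
    sqrt ((\<integral>x. (T x)\<^sup>2 \<partial>gauss_model n (\<lambda>_. 0)) *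
      ((\<Sum>f\<in>F. \<Sum>g\<in>F. exp (\<Sum>i=1..n. \<Theta> f i * \<Theta> g i)) / (card F)\<^sup>2 - 1))"
proof -
  let ?Z = "gauss_model n (\<lambda>_. 0)"
  let ?L = "\<lambda>f. gauss_likelihood n (\<Theta> f)"
  interpret prob_space ?Z by (rule prob_space_gauss_model)
  note [measurable] = T
  have N: "real (card F) > 0" using F by (simp add: card_gt_0_iff)
  have LL: "integrable ?Z (\<lambda>x. ?L f x * ?L g x)"
    "(\<integral>x. ?L f x * ?L g x \<partial>?Z) = exp (\<Sum>i=1..n. \<Theta> f i * \<Theta> g i)" for f g
    using has_bochner_integral_gauss_likelihood[of n "\<lambda>i. \<Theta> f i + \<Theta> g i"]
    by (simp_all add: gauss_likelihood_mult has_bochner_integral_iff)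
  have T1: "integrable ?Z T"
    using square_integrable_imp_integrable[of T] T2 by simp
  have TL: "integrable ?Z (\<lambda>x. ?L f x * T x)" "(\<integral>x. ?L f x * T x \<partial>?Z) = mean n T (\<Theta> f)"
    if "f \<in> F" for f
  proof -
    have "integrable (density ?Z (\<lambda>x. ennreal (?L f x))) T"
      using TF[OF that] unfolding gauss_model_eq_density[of n "\<Theta> f"] .
    then show "integrable ?Z (\<lambda>x. ?L f x * T x)"
      by (subst (asm) integrable_density) auto
    have "mean n T (\<Theta> f) = (\<integral>x. T x \<partial>density ?Z (\<lambda>x. ennreal (?L f x)))"
      unfolding mean_def gauss_model_eq_density[of n "\<Theta> f"] ..
    also have "\<dots> = (\<integral>x. ?L f x * T x \<partial>?Z)"
      by (subst integral_density) auto
    finally show "(\<integral>x. ?L f x * T x \<partial>?Z) = mean n T (\<Theta> f)" ..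
  qed
  \<comment> \<open>\<open>G\<close> is the density of the mixture relative to the law at 0, minus
    1. Integrated against \<open>T\<close> it gives the difference of the means; its square
    integrates to the chi-square divergence.\<close>
  define G where "G x = (\<Sum>f\<in>F. ?L f x) / card F - 1" for x
  have [measurable]: "G \<in> borel_measurable ?Z"
    unfolding G_def by measurable
  have square: "(a / c - 1)\<^sup>2 = a * a / c\<^sup>2 - 2 * a / c + 1" for a c :: real
    by (simp add: power2_diff power_divide) (simp add: power2_eq_square)
  have G2: "(G x)\<^sup>2 = (\<Sum>f\<in>F. \<Sum>g\<in>F. ?L f x * ?L g x) / (card F)\<^sup>2 - 2 * (\<Sum>f\<in>F. ?L f x) / card F + 1" for x
    unfolding G_def square sum_product by simp
  have sums: "has_bochner_integral ?Z (\<lambda>x. \<Sum>f\<in>F. \<Sum>g\<in>F. ?L f x * ?L g x)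
      (\<Sum>f\<in>F. \<Sum>g\<in>F. exp (\<Sum>i=1..n. \<Theta> f i * \<Theta> g i))"
    "has_bochner_integral ?Z (\<lambda>x. \<Sum>f\<in>F. ?L f x) (\<Sum>f\<in>F. 1)"
    "has_bochner_integral ?Z (\<lambda>x. 1) (1::real)"
  proof -
    show "has_bochner_integral ?Z (\<lambda>x. \<Sum>f\<in>F. \<Sum>g\<in>F. ?L f x * ?L g x)
        (\<Sum>f\<in>F. \<Sum>g\<in>F. exp (\<Sum>i=1..n. \<Theta> f i * \<Theta> g i))"
      using LL by (intro has_bochner_integral_sum) (simp add: has_bochner_integral_iff)
    show "has_bochner_integral ?Z (\<lambda>x. \<Sum>f\<in>F. ?L f x) (\<Sum>f\<in>F. 1)"
      by (intro has_bochner_integral_sum has_bochner_integral_gauss_likelihood)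
    have "(\<integral>x. 1 \<partial>?Z) = (1::real)"
      by (simp add: prob_space)
    then show "has_bochner_integral ?Z (\<lambda>x. 1) (1::real)"
      using integrable_const[of "1::real"] unfolding has_bochner_integral_iff by blast
  qed
  have "has_bochner_integral ?Z (\<lambda>x. (G x)\<^sup>2)
      ((\<Sum>f\<in>F. \<Sum>g\<in>F. exp (\<Sum>i=1..n. \<Theta> f i * \<Theta> g i)) / (card F)\<^sup>2 - 2 * (\<Sum>f\<in>F. 1) / card F + 1)"
    unfolding G2
    by (rule has_bochner_integral_add has_bochner_integral_diff has_bochner_integral_divide_zero
        has_bochner_integral_mult_right sums)+
  then have G2i: "integrable ?Z (\<lambda>x. (G x)\<^sup>2)"
    and G2v: "(\<integral>x. (G x)\<^sup>2 \<partial>?Z) = (\<Sum>f\<in>F. \<Sum>g\<in>F. exp (\<Sum>i=1..n. \<Theta> f i * \<Theta> g i)) / (card F)\<^sup>2 - 1"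
    using N by (simp_all add: has_bochner_integral_iff)
  have "T x * G x = (\<Sum>f\<in>F. ?L f x * T x) / card F - T x" for x
    unfolding G_def sum_distrib_right[symmetric] by (simp add: right_diff_distrib)
  then have "(\<integral>x. T x * G x \<partial>?Z) = (\<integral>x. (\<Sum>f\<in>F. ?L f x * T x) / card F - T x \<partial>?Z)"
    by (simp only:)
  also have "\<dots> = (\<integral>x. (\<Sum>f\<in>F. ?L f x * T x) / card F \<partial>?Z) - (\<integral>x. T x \<partial>?Z)"
    using TL(1) T1 by (intro Bochner_Integration.integral_diff integrable_divide
        Bochner_Integration.integrable_sum) auto
  also have "(\<integral>x. (\<Sum>f\<in>F. ?L f x * T x) / card F \<partial>?Z) = (\<Sum>f\<in>F. \<integral>x. ?L f x * T x \<partial>?Z) / card F"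
    using TL(1) by (subst integral_divide_zero, subst Bochner_Integration.integral_sum) auto
  also have "(\<Sum>f\<in>F. \<integral>x. ?L f x * T x \<partial>?Z) = (\<Sum>f\<in>F. mean n T (\<Theta> f))"
    using TL(2) by (rule sum.cong[OF refl])
  also have "(\<integral>x. T x \<partial>?Z) = mean n T (\<lambda>_. 0)"
    by (simp add: mean_def)
  finally show ?thesis
    using integral_Cauchy_Schwarz[of T ?Z G] T2 G2i G2v by simp
qed

section \<open>The random spikes and their chi-square divergence\<close>

text \<open>The values of \<open>g\<close> vary independently, so the sum factors over
  \<open>j\<close>. In each factor one value agrees with \<open>f j\<close> and contributes
  \<open>exp r\<close>, and the other \<open>k - 1\<close> contribute 1. The result is the same for
  every \<open>f\<close>.\<close>

lemma sum_PiE_exp_agreements: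
  fixes r :: real
  assumes f: "f \<in> {..<s} \<rightarrow>\<^sub>E {..<k}"
  shows "(\<Sum>g\<in>{..<s} \<rightarrow>\<^sub>E {..<k}. exp (\<Sum>j<s. if f j = g j then r else 0)) = (real k - 1 + exp r) ^ s"
proof -
  have "(\<Sum>g\<in>{..<s} \<rightarrow>\<^sub>E {..<k}. exp (\<Sum>j<s. if f j = g j then r else 0)) =
      (\<Sum>g\<in>{..<s} \<rightarrow>\<^sub>E {..<k}. \<Prod>j<s. if f j = g j then exp r else 1)"
    by (simp add: exp_sum if_distrib[of exp] cong: if_cong)
  also have "\<dots> = (\<Prod>j<s. \<Sum>b<k. if f j = b then exp r else 1)"
    by (rule prod_sum_PiE[symmetric]) auto
  also have "\<dots> = (\<Prod>j<s. real k - 1 + exp r)"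
  proof (rule prod.cong[OF refl])
    fix j assume "j \<in> {..<s}"
    then have "f j < k" using f by auto
    have "(\<Sum>b<k. if f j = b then exp r else 1) = (\<Sum>b<k. 1 + (if b = f j then exp r - 1 else 0))"
      by (rule sum.cong) auto
    also have "\<dots> = real k - 1 + exp r"
      using \<open>f j < k\<close> by (simp add: sum.distrib)
    finally show "(\<Sum>b<k. if f j = b then exp r else 1) = real k - 1 + exp r" .
  qed
  finally show ?thesis by simp
qed

text \<open>One spike of height \<open>\<rho>\<close> in each of the first \<open>s\<close> blocks of length \<open>k\<close>; the vector
  is indexed from 1, the blocks and the positions inside a block from 0.\<close>

definition spikes :: "nat \<Rightarrow> nat \<Rightarrow> nat \<Rightarrow> real \<Rightarrow> (nat \<Rightarrow> nat) \<Rightarrow> nat \<Rightarrow> real" where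
  "spikes n s k \<rho> f =
     (\<lambda>i\<in>{1..n}. if (i - 1) div k < s \<and> f ((i - 1) div k) = (i - 1) mod k then \<rho> else 0)"

text \<open>\<open>j * k + f j + 1\<close> is where \<open>f\<close> puts its spike in block
  \<open>j\<close>. Evaluating the vector of \<open>g\<close> there shows that two spike vectors
  overlap exactly in the blocks where \<open>f\<close> and \<open>g\<close> agree.\<close>

lemma spikes_at:
  assumes "f \<in> {..<s} \<rightarrow>\<^sub>E {..<k}" "g \<in> {..<s} \<rightarrow>\<^sub>E {..<k}" "s * k \<le> n" "j < s"
  shows "j * k + f j + 1 \<in> {1..n}"
    and "spikes n s k \<rho> g (j * k + f j + 1) = (if f j = g j then \<rho> else 0)"
proof -
  have fj: "f j < k" using assms by auto
  have "(j + 1) * k \<le> s * k" using assms by (intro mult_le_mono1) auto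
  then show in_n: "j * k + f j + 1 \<in> {1..n}" using fj assms by simp
  then show "spikes n s k \<rho> g (j * k + f j + 1) = (if f j = g j then \<rho> else 0)"
    using fj assms by (simp add: spikes_def)
qed

lemma spikes_support:
  assumes "i \<in> {1..n}" "spikes n s k \<rho> f i \<noteq> 0"
  shows "i \<in> (\<lambda>j. j * k + f j + 1) ` {..<s}"
proof
  show "(i - 1) div k \<in> {..<s}"
    using assms by (auto simp: spikes_def split: if_splits)
  have "f ((i - 1) div k) = (i - 1) mod k"
    using assms by (auto simp: spikes_def split: if_splits)
  then show "i = (i - 1) div k * k + f ((i - 1) div k) + 1"
    using assms by simp
qed

text \<open>Only the spike positions of \<open>f\<close> contribute. Division by \<open>k\<close>
  recovers the block from the position, so the sum can be reindexed by blocks.\<close>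

lemma spikes_inner:
  assumes f: "f \<in> {..<s} \<rightarrow>\<^sub>E {..<k}" and g: "g \<in> {..<s} \<rightarrow>\<^sub>E {..<k}" and "s * k \<le> n"
  shows "(\<Sum>i=1..n. spikes n s k \<rho> f i * spikes n s k \<rho> g i) = (\<Sum>j<s. if f j = g j then \<rho>\<^sup>2 else 0)"
proof -
  let ?p = "\<lambda>j. j * k + f j + 1"
  have inj: "inj_on ?p {..<s}"
  proof (rule inj_on_inverseI)
    fix j assume "j \<in> {..<s}"
    then have "f j < k" using f by auto
    then show "(?p j - 1) div k = j" by simp
  qed
  have "(\<Sum>i=1..n. spikes n s k \<rho> f i * spikes n s k \<rho> g i) =
      (\<Sum>i\<in>?p ` {..<s}. spikes n s k \<rho> f i * spikes n s k \<rho> g i)"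
    using spikes_at(1)[OF f g \<open>s * k \<le> n\<close>] spikes_support[of _ n s k \<rho> f]
    by (intro sum.mono_neutral_right) fastforce+
  also have "\<dots> = (\<Sum>j<s. if f j = g j then \<rho>\<^sup>2 else 0)"
    unfolding sum.reindex[OF inj] comp_def
    using spikes_at(2)[OF f f \<open>s * k \<le> n\<close>] spikes_at(2)[OF f g \<open>s * k \<le> n\<close>]
    by (intro sum.cong) (auto simp: power2_eq_square)
  finally show ?thesis .
qed

lemma sq_norm_spikes:
  assumes "f \<in> {..<s} \<rightarrow>\<^sub>E {..<k}" "s * k \<le> n"
  shows "sq_norm n (spikes n s k \<rho> f) = s * \<rho>\<^sup>2"
  using spikes_inner[OF assms(1,1,2)] by (simp add: sq_norm_def power2_eq_square)

lemma spikes_sparse: "spikes n s k \<rho> f \<in> sparse_vectors n s"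
proof -
  have "card {i \<in> {1..n}. spikes n s k \<rho> f i \<noteq> 0} \<le> card ((\<lambda>j. j * k + f j + 1) ` {..<s})"
    using spikes_support[of _ n s k \<rho> f] by (intro card_mono) auto
  also have "\<dots> \<le> card {..<s}" by (rule card_image_le) simp
  finally show ?thesis
    by (auto simp: sparse_vectors_def spikes_def)
qed

text \<open>The inner sum does not depend on \<open>f\<close>, so the quotient is exactly the
  \<open>s\<close>-th power of \<open>1 + (exp (\<rho>\<^sup>2) - 1) / k\<close>; then
  \<open>1 + x \<le> exp x\<close> applies.\<close>

lemma spikes_chi_square:
  assumes "s * k \<le> n" "1 \<le> k"
  defines "F \<equiv> {..<s} \<rightarrow>\<^sub>E {..<k}"
  shows "(\<Sum>f\<in>F. \<Sum>g\<in>F. exp (\<Sum>i=1..n. spikes n s k \<rho> f i * spikes n s k \<rho> g i)) / (card F)\<^sup>2 \<le>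
    exp (s * (exp (\<rho>\<^sup>2) - 1) / k)"
proof -
  have "(\<Sum>f\<in>F. \<Sum>g\<in>F. exp (\<Sum>i=1..n. spikes n s k \<rho> f i * spikes n s k \<rho> g i)) =
      card F * (real k - 1 + exp (\<rho>\<^sup>2)) ^ s"
    using \<open>s * k \<le> n\<close> unfolding F_def by (simp add: spikes_inner sum_PiE_exp_agreements del: One_nat_def)
  moreover have "card F = k ^ s"
    by (simp add: F_def card_PiE)
  ultimately have "(\<Sum>f\<in>F. \<Sum>g\<in>F. exp (\<Sum>i=1..n. spikes n s k \<rho> f i * spikes n s k \<rho> g i)) / (card F)\<^sup>2 =
      ((real k - 1 + exp (\<rho>\<^sup>2)) / k) ^ s"
    using assms by (simp add: power2_eq_square power_divide)
  also have "(real k - 1 + exp (\<rho>\<^sup>2)) / k = 1 + (exp (\<rho>\<^sup>2) - 1) / k"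
    using assms by (simp add: field_simps)
  also have "(1 + (exp (\<rho>\<^sup>2) - 1) / k) ^ s \<le> exp ((exp (\<rho>\<^sup>2) - 1) / k) ^ s"
    by (intro power_mono exp_ge_add_one_self add_nonneg_nonneg divide_nonneg_nonneg) auto
  finally show ?thesis
    by (simp flip: exp_of_nat_mult)
qed

section \<open>The trade-off between bias and risk\<close>

lemma zero_in_param_space:
  assumes "1 \<le> s"
  shows "(\<lambda>i\<in>{1..n}. 0) \<in> param_space n s"
  using assms by (auto simp: param_space_def sparse_vectors_def sq_norm_def cong: conj_cong)

text \<open>Reconciles two zero vectors: parameters must be extensional, whereas the likelihoods
  refer to the total function \<open>\<lambda>_. 0\<close>.\<close>

lemma gauss_model_zero: "gauss_model n (\<lambda>i\<in>{1..n}. 0) = gauss_model n (\<lambda>_. 0)"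
  unfolding gauss_model_def by (rule PiM_cong) auto

text \<open>The square of the mean error is at most its second moment, by Cauchy-Schwarz against the
  constant 1. Infinite risk is a trivial separate case.\<close>

lemma worst_sq_bias_le_worst_mse:
  assumes "T \<in> estimators n s"
  shows "worst_sq_bias n s T \<le> worst_mse n s T"
  unfolding worst_sq_bias_def worst_mse_def
proof (rule SUP_mono)
  fix \<theta> assume \<theta>: "\<theta> \<in> param_space n s"
  interpret prob_space "gauss_model n \<theta>" by (rule prob_space_gauss_model)
  have [measurable]: "T \<in> borel_measurable (\<Pi>\<^sub>M i\<in>{1..n}. borel)" and T: "integrable (gauss_model n \<theta>) T"
    using assms \<theta> by (auto simp: estimators_def)
  have "ennreal ((mean n T \<theta> - sq_norm n \<theta>)\<^sup>2) \<le> mse n T \<theta>"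
  proof (cases "mse n T \<theta> = \<infinity>")
    case False
    let ?f = "\<lambda>x. T x - sq_norm n \<theta>"
    have f2: "integrable (gauss_model n \<theta>) (\<lambda>x. (?f x)\<^sup>2)"
      using False by (intro integrableI_nonneg) (auto simp: mse_def top.not_eq_extremum)
    have "\<bar>\<integral>x. ?f x * 1 \<partial>gauss_model n \<theta>\<bar> \<le>
        sqrt ((\<integral>x. (?f x)\<^sup>2 \<partial>gauss_model n \<theta>) * (\<integral>x. 1\<^sup>2 \<partial>gauss_model n \<theta>))"
      by (rule integral_Cauchy_Schwarz) (use f2 in auto)
    then have "\<bar>mean n T \<theta> - sq_norm n \<theta>\<bar> \<le> sqrt (\<integral>x. (?f x)\<^sup>2 \<partial>gauss_model n \<theta>)"
      using T by (simp add: mean_def prob_space)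
    then have "(mean n T \<theta> - sq_norm n \<theta>)\<^sup>2 \<le> (\<integral>x. (?f x)\<^sup>2 \<partial>gauss_model n \<theta>)"
      using sqrt_ge_absD by blast
    then show ?thesis
      using f2 by (simp add: mse_def nn_integral_eq_integral)
  qed simp
  then show "\<exists>\<eta>\<in>param_space n s. ennreal ((mean n T \<theta> - sq_norm n \<theta>)\<^sup>2) \<le> mse n T \<eta>"
    using \<theta> by blast
qed

text \<open>With bias at most \<open>b\<close>, the mean of \<open>T\<close> is at most
  \<open>b\<close> at 0 and on average at least \<open>s' * \<rho>\<^sup>2 - b\<close> over the
  spike vectors, while Cauchy-Schwarz limits this difference. Keeping \<open>b\<close> and
  \<open>m\<close> apart allows lower bounds for the bias as well as for the risk. The number
  \<open>s'\<close> of spikes may be smaller than \<open>s\<close>, which the dense regime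
  uses.\<close>

lemma sq_norm_le_bias_plus_risk:
  fixes s s' k :: nat and \<rho> :: real
  assumes T: "T \<in> estimators n s"
    and "1 \<le> s'" "s' \<le> s" "1 \<le> k" "s' * k \<le> n"
    and \<rho>: "s' * \<rho>\<^sup>2 \<le> 2 * s * ln (1 + sqrt n / s)"
    and b: "worst_sq_bias n s T \<le> ennreal (b\<^sup>2)" "0 \<le> b"
    and m: "worst_mse n s T \<le> ennreal m" "0 \<le> m"
  shows "s' * \<rho>\<^sup>2 \<le> 2 * b + sqrt (m * (exp (s' * (exp (\<rho>\<^sup>2) - 1) / k) - 1))"
proof -
  let ?Z = "gauss_model n (\<lambda>_. 0)"
  define F where "F = {..<s'} \<rightarrow>\<^sub>E {..<k}"
  define \<Theta> where "\<Theta> = spikes n s' k \<rho>"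
  have F: "finite F" "F \<noteq> {}"
    using \<open>1 \<le> k\<close> by (auto simp: F_def finite_PiE PiE_eq_empty_iff lessThan_empty_iff)
  have T_meas [measurable]: "T \<in> borel_measurable (\<Pi>\<^sub>M i\<in>{1..n}. borel)"
    and T_int: "\<And>\<theta>. \<theta> \<in> param_space n s \<Longrightarrow> integrable (gauss_model n \<theta>) T"
    using T by (auto simp: estimators_def)
  have \<Theta>: "\<Theta> f \<in> param_space n s" "sq_norm n (\<Theta> f) = s' * \<rho>\<^sup>2" if "f \<in> F" for f
  proof -
    show *: "sq_norm n (\<Theta> f) = s' * \<rho>\<^sup>2"
      using that assms by (simp add: \<Theta>_def F_def sq_norm_spikes)
    show "\<Theta> f \<in> param_space n s"
      using * spikes_sparse[of n s' k \<rho> f] \<open>s' \<le> s\<close> \<rho>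
      by (auto simp: param_space_def sparse_vectors_def \<Theta>_def)
  qed
  have bias: "\<bar>mean n T \<theta> - sq_norm n \<theta>\<bar> \<le> b" if "\<theta> \<in> param_space n s" for \<theta>
  proof -
    have "ennreal ((mean n T \<theta> - sq_norm n \<theta>)\<^sup>2) \<le> ennreal (b\<^sup>2)"
      using order_trans[OF SUP_upper[OF that] b(1)[unfolded worst_sq_bias_def]] .
    then show ?thesis
      using b(2) abs_le_square_iff[of "mean n T \<theta> - sq_norm n \<theta>" b] by simp
  qed
  have zero: "(\<lambda>i\<in>{1..n}. 0) \<in> param_space n s"
    using assms by (intro zero_in_param_space) auto
  \<comment> \<open>The functional vanishes at 0, so the second moment of \<open>T\<close> there is
    its mean squared error.\<close>
  have "(\<integral>\<^sup>+x. ennreal ((T x)\<^sup>2) \<partial>?Z) = mse n T (\<lambda>i\<in>{1..n}. 0)"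
    unfolding mse_def gauss_model_zero by (simp add: sq_norm_def)
  also have "\<dots> \<le> ennreal m"
    using order_trans[OF SUP_upper[OF zero] m(1)[unfolded worst_mse_def]] .
  finally have T2: "(\<integral>\<^sup>+x. ennreal ((T x)\<^sup>2) \<partial>?Z) \<le> ennreal m" .
  then have T2i: "integrable ?Z (\<lambda>x. (T x)\<^sup>2)"
    by (intro integrableI_nonneg) (auto simp: le_less_trans)
  then have T2m: "(\<integral>x. (T x)\<^sup>2 \<partial>?Z) \<le> m"
    using T2 m(2) by (simp add: nn_integral_eq_integral)
  have "\<bar>mean n T (\<lambda>_. 0)\<bar> \<le> b"
    using bias[OF zero] unfolding mean_def gauss_model_zero by (simp add: sq_norm_def)
  moreover have "s' * \<rho>\<^sup>2 - b \<le> (\<Sum>f\<in>F. mean n T (\<Theta> f)) / card F"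
  proof -
    have "card F * (s' * \<rho>\<^sup>2 - b) = (\<Sum>f\<in>F. s' * \<rho>\<^sup>2 - b)" by simp
    also have "\<dots> \<le> (\<Sum>f\<in>F. mean n T (\<Theta> f))"
      using bias[OF \<Theta>(1)] \<Theta>(2) by (intro sum_mono) (fastforce simp: abs_le_iff)
    finally show ?thesis
      using F by (simp add: field_simps card_gt_0_iff)
  qed
  moreover have "\<bar>(\<Sum>f\<in>F. mean n T (\<Theta> f)) / card F - mean n T (\<lambda>_. 0)\<bar> \<le>
      sqrt (m * (exp (s' * (exp (\<rho>\<^sup>2) - 1) / k) - 1))"
  proof -
    let ?V = "\<integral>x. (T x)\<^sup>2 \<partial>?Z"
    have "\<bar>(\<Sum>f\<in>F. mean n T (\<Theta> f)) / card F - mean n T (\<lambda>_. 0)\<bar> \<le>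
      sqrt (?V * ((\<Sum>f\<in>F. \<Sum>g\<in>F. exp (\<Sum>i=1..n. \<Theta> f i * \<Theta> g i)) / (card F)\<^sup>2 - 1))"
      by (rule mixture_mean_diff_le[OF T_meas T2i T_int[OF \<Theta>(1)] F])
    also have "\<dots> \<le> sqrt (?V * (exp (s' * (exp (\<rho>\<^sup>2) - 1) / k) - 1))"
      using spikes_chi_square[OF \<open>s' * k \<le> n\<close> \<open>1 \<le> k\<close>, of \<rho>]
      by (intro real_sqrt_le_mono mult_left_mono) (auto simp: \<Theta>_def F_def)
    also have "\<dots> \<le> sqrt (m * (exp (s' * (exp (\<rho>\<^sup>2) - 1) / k) - 1))"
      using T2m by (intro real_sqrt_le_mono mult_right_mono) auto
    finally show ?thesis .
  qed
  ultimately show ?thesis by linarith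
qed

section \<open>The quadratic estimator: moments and worst-case risk\<close>

text \<open>Expand the square of the sum: by independence and centering the off-diagonal terms
  integrate to 0.\<close>

lemma (in product_prob_space) second_moment_sum_centered:
  fixes f :: "'i \<Rightarrow> 'a \<Rightarrow> real"
  assumes J: "finite J"
    and f: "\<And>i. i \<in> J \<Longrightarrow> integrable (M i) (f i)" "\<And>i. i \<in> J \<Longrightarrow> (\<integral>x. f i x \<partial>M i) = 0"
    and f2: "\<And>i. i \<in> J \<Longrightarrow> integrable (M i) (\<lambda>x. (f i x)\<^sup>2)"
  shows "has_bochner_integral (Pi\<^sub>M J M) (\<lambda>x. \<Sum>i\<in>J. f i (x i)) 0"
    and "has_bochner_integral (Pi\<^sub>M J M) (\<lambda>x. (\<Sum>i\<in>J. f i (x i))\<^sup>2) (\<Sum>i\<in>J. \<integral>x. (f i x)\<^sup>2 \<partial>M i)"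
proof -
  have M1: "(\<integral>x. 1 \<partial>M i) = (1::real)" "integrable (M i) (\<lambda>x. 1::real)" for i
    by (auto simp: M.prob_space)
  have prod: "has_bochner_integral (Pi\<^sub>M J M) (\<lambda>x. \<Prod>i\<in>J. g i (x i)) (\<Prod>i\<in>J. \<integral>x. g i x \<partial>M i)"
    if "\<And>i. i \<in> J \<Longrightarrow> integrable (M i) (g i)" for g :: "'i \<Rightarrow> 'a \<Rightarrow> real"
    using product_integral_prod[OF J that] product_integrable_prod[OF J that]
    by (simp add: has_bochner_integral_iff)
  have single: "has_bochner_integral (Pi\<^sub>M J M) (\<lambda>x. h (x i)) (\<integral>x. h x \<partial>M i)"
    if i: "i \<in> J" and h: "integrable (M i) h" for i and h :: "'a \<Rightarrow> real"
  proof -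
    \<comment> \<open>Padding with factors 1 turns a function of one coordinate into a product over
      all of \<open>J\<close>, to which the product formula applies. The mixed terms below are
      padded in the same way.\<close>
    let ?g = "\<lambda>k. if k = i then h else (\<lambda>_. 1)"
    have "has_bochner_integral (Pi\<^sub>M J M) (\<lambda>x. \<Prod>k\<in>J. ?g k (x k)) (\<Prod>k\<in>J. \<integral>x. ?g k x \<partial>M k)"
      using h M1 by (intro prod) auto
    moreover have "(\<Prod>k\<in>J. ?g k (x k)) = h (x i)" for x
      using i J by (simp add: if_distribR prod.delta cong: if_cong)
    moreover have "(\<Prod>k\<in>J. \<integral>x. ?g k x \<partial>M k) = (\<Prod>k\<in>J. if k = i then \<integral>x. h x \<partial>M i else 1)"
      using M1 by (intro prod.cong) auto
    ultimately show ?thesis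
      using i J by (simp add: prod.delta)
  qed
  show "has_bochner_integral (Pi\<^sub>M J M) (\<lambda>x. \<Sum>i\<in>J. f i (x i)) 0"
  proof -
    have "has_bochner_integral (Pi\<^sub>M J M) (\<lambda>x. f i (x i)) 0" if "i \<in> J" for i
      using single[OF that f(1)[OF that]] f(2)[OF that] by simp
    then show ?thesis
      using has_bochner_integral_sum[of J "Pi\<^sub>M J M" "\<lambda>i x. f i (x i)" "\<lambda>_. 0"] by simp
  qed
  have cross: "has_bochner_integral (Pi\<^sub>M J M) (\<lambda>x. f i (x i) * f j (x j)) (if i = j then \<integral>x. (f i x)\<^sup>2 \<partial>M i else 0)"
    if i: "i \<in> J" and j: "j \<in> J" for i j
  proof (cases "i = j")
    case True
    then show ?thesis
      using single[OF i f2[OF i]] by (simp add: power2_eq_square)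
  next
    case False
    let ?g = "\<lambda>k. if k \<in> {i, j} then f k else (\<lambda>_. 1)"
    have "has_bochner_integral (Pi\<^sub>M J M) (\<lambda>x. \<Prod>k\<in>J. ?g k (x k)) (\<Prod>k\<in>J. \<integral>x. ?g k x \<partial>M k)"
      using f M1 by (intro prod) auto
    moreover have "(\<Prod>k\<in>J. ?g k (x k)) = f i (x i) * f j (x j)" for x
    proof -
      have "(\<Prod>k\<in>J. ?g k (x k)) = (\<Prod>k\<in>{i, j}. ?g k (x k))"
        using i j J by (intro prod.mono_neutral_right) auto
      then show ?thesis using False by simp
    qed
    moreover have "(\<Prod>k\<in>J. \<integral>x. ?g k x \<partial>M k) = 0"
      using i J f(2) by (intro prod_zero) (auto intro!: bexI[of _ i])
    ultimately show ?thesis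
      using False by simp
  qed
  have "has_bochner_integral (Pi\<^sub>M J M) (\<lambda>x. \<Sum>i\<in>J. \<Sum>j\<in>J. f i (x i) * f j (x j))
      (\<Sum>i\<in>J. \<Sum>j\<in>J. if i = j then \<integral>x. (f i x)\<^sup>2 \<partial>M i else 0)"
    using cross by (intro has_bochner_integral_sum) auto
  then show "has_bochner_integral (Pi\<^sub>M J M) (\<lambda>x. (\<Sum>i\<in>J. f i (x i))\<^sup>2) (\<Sum>i\<in>J. \<integral>x. (f i x)\<^sup>2 \<partial>M i)"
    using J by (simp add: power2_eq_square sum_product sum.delta)
qed

lemma normal_law_central_moments:
  "has_bochner_integral (normal_law \<mu>) (\<lambda>x. 1) (1::real)"
  "has_bochner_integral (normal_law \<mu>) (\<lambda>x. x - \<mu>) 0"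
  "has_bochner_integral (normal_law \<mu>) (\<lambda>x. (x - \<mu>)^2) 1"
  "has_bochner_integral (normal_law \<mu>) (\<lambda>x. (x - \<mu>)^3) 0"
  "has_bochner_integral (normal_law \<mu>) (\<lambda>x. (x - \<mu>)^4) 3"
proof -
  have even: "has_bochner_integral (normal_law \<mu>) (\<lambda>x. (x - \<mu>) ^ (2 * k)) (fact (2 * k) / (2 ^ k * fact k))" for k
    using normal_moment_even[of 1 \<mu> k] by (intro has_bochner_integral_density) auto
  have odd: "has_bochner_integral (normal_law \<mu>) (\<lambda>x. (x - \<mu>) ^ (2 * k + 1)) 0" for k
    using normal_moment_odd[of 1 \<mu> k] by (intro has_bochner_integral_density) auto
  show "has_bochner_integral (normal_law \<mu>) (\<lambda>x. 1) (1::real)" using even[of 0] by simp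
  show "has_bochner_integral (normal_law \<mu>) (\<lambda>x. x - \<mu>) 0" using odd[of 0] by simp
  show "has_bochner_integral (normal_law \<mu>) (\<lambda>x. (x - \<mu>)^2) 1" using even[of 1] by (simp add: fact_numeral)
  show "has_bochner_integral (normal_law \<mu>) (\<lambda>x. (x - \<mu>)^3) 0" using odd[of 1] by simp
  show "has_bochner_integral (normal_law \<mu>) (\<lambda>x. (x - \<mu>)^4) 3" using even[of 2] by (simp add: fact_numeral)
qed

text \<open>In powers of \<open>x - \<mu>\<close> the centered square is
  \<open>(x - \<mu>)^2 + 2 * \<mu> * (x - \<mu>) - 1\<close>; its square is a quartic, so central
  moments up to order four suffice.\<close>

lemma normal_law_centered_square:
  defines "f \<equiv> \<lambda>\<mu> x::real. x\<^sup>2 - 1 - \<mu>\<^sup>2"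
  shows "has_bochner_integral (normal_law \<mu>) (f \<mu>) 0"
    and "has_bochner_integral (normal_law \<mu>) (\<lambda>x. (f \<mu> x)\<^sup>2) (2 + 4 * \<mu>\<^sup>2)"
proof -
  note M = normal_law_central_moments[of \<mu>]
  have "has_bochner_integral (normal_law \<mu>) (\<lambda>x. (x - \<mu>)^2 + 2 * \<mu> * (x - \<mu>) - 1) (1 + 2 * \<mu> * 0 - 1)"
    by (intro has_bochner_integral_add has_bochner_integral_diff has_bochner_integral_mult_right M)
  moreover have "(\<lambda>x. (x - \<mu>)^2 + 2 * \<mu> * (x - \<mu>) - 1) = f \<mu>"
    by (auto simp: f_def power2_eq_square algebra_simps)
  ultimately show "has_bochner_integral (normal_law \<mu>) (f \<mu>) 0" by simp
  have "has_bochner_integral (normal_law \<mu>)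
      (\<lambda>x. (x - \<mu>)^4 + 4 * \<mu> * (x - \<mu>)^3 + (4 * \<mu>\<^sup>2 - 2) * (x - \<mu>)^2 - 4 * \<mu> * (x - \<mu>) + 1)
      (3 + 4 * \<mu> * 0 + (4 * \<mu>\<^sup>2 - 2) * 1 - 4 * \<mu> * 0 + 1)"
    by (intro has_bochner_integral_add has_bochner_integral_diff has_bochner_integral_mult_right M)
  moreover have "(x - \<mu>)^4 + 4 * \<mu> * (x - \<mu>)^3 + (4 * \<mu>\<^sup>2 - 2) * (x - \<mu>)^2 - 4 * \<mu> * (x - \<mu>) + 1 = (f \<mu> x)\<^sup>2" for x
    unfolding f_def by algebra
  ultimately show "has_bochner_integral (normal_law \<mu>) (\<lambda>x. (f \<mu> x)\<^sup>2) (2 + 4 * \<mu>\<^sup>2)" by simp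
qed

text \<open>The 1 is subtracted inside the sum: each squared observation has mean
  \<open>(\<theta> i)\<^sup>2 + 1\<close>.\<close>

definition quadratic_estimator :: "nat \<Rightarrow> (nat \<Rightarrow> real) \<Rightarrow> real" where
  "quadratic_estimator n x = (\<Sum>i=1..n. (x i)\<^sup>2 - 1)"

text \<open>The error is a sum of independent centered terms, each with second moment
  \<open>2 + 4 * (\<theta> i)\<^sup>2\<close>.\<close>

lemma quadratic_estimator_error:
  shows "has_bochner_integral (gauss_model n \<theta>) (\<lambda>x. quadratic_estimator n x - sq_norm n \<theta>) 0"
    and "has_bochner_integral (gauss_model n \<theta>) (\<lambda>x. (quadratic_estimator n x - sq_norm n \<theta>)\<^sup>2)
     (2 * real n + 4 * sq_norm n \<theta>)"
proof -
  interpret product_prob_space "\<lambda>i. normal_law (\<theta> i)"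
    by (rule product_prob_space_normal_law)
  let ?f = "\<lambda>i x. x\<^sup>2 - 1 - (\<theta> i)\<^sup>2"
  have error: "quadratic_estimator n x - sq_norm n \<theta> = (\<Sum>i\<in>{1..n}. ?f i (x i))" for x
    by (simp add: quadratic_estimator_def sq_norm_def sum_subtractf)
  have second_moment: "(\<Sum>i\<in>{1..n}. \<integral>x. (?f i x)\<^sup>2 \<partial>normal_law (\<theta> i)) = 2 * real n + 4 * sq_norm n \<theta>"
    by (simp add: has_bochner_integral_integral_eq[OF normal_law_centered_square(2)]
        sq_norm_def sum.distrib sum_distrib_left)
  have f: "integrable (normal_law (\<theta> i)) (?f i)" "(\<integral>x. ?f i x \<partial>normal_law (\<theta> i)) = 0"
    "integrable (normal_law (\<theta> i)) (\<lambda>x. (?f i x)\<^sup>2)" for i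
    using normal_law_centered_square[of "\<theta> i"] unfolding has_bochner_integral_iff by blast+
  note sums = second_moment_sum_centered[OF finite_atLeastAtMost[of 1 n], of ?f, OF f]
  show "has_bochner_integral (gauss_model n \<theta>) (\<lambda>x. quadratic_estimator n x - sq_norm n \<theta>) 0"
    unfolding gauss_model_def error by (rule sums(1))
  show "has_bochner_integral (gauss_model n \<theta>) (\<lambda>x. (quadratic_estimator n x - sq_norm n \<theta>)\<^sup>2)
     (2 * real n + 4 * sq_norm n \<theta>)"
    unfolding gauss_model_def error second_moment[symmetric] by (rule sums(2))
qed

lemma quadratic_estimator_mean:
  "has_bochner_integral (gauss_model n \<theta>) (quadratic_estimator n) (sq_norm n \<theta>)"
proof -
  interpret prob_space "gauss_model n \<theta>" by (rule prob_space_gauss_model)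
  have "has_bochner_integral (gauss_model n \<theta>) (\<lambda>x. sq_norm n \<theta>) (sq_norm n \<theta>)"
    by (simp add: has_bochner_integral_iff prob_space)
  from has_bochner_integral_add[OF quadratic_estimator_error(1) this] show ?thesis
    by simp
qed

lemma quadratic_estimator_in_estimators: "quadratic_estimator n \<in> estimators n s"
proof -
  have "quadratic_estimator n \<in> borel_measurable (\<Pi>\<^sub>M i\<in>{1..n}. borel)"
    unfolding quadratic_estimator_def by measurable
  then show ?thesis
    using quadratic_estimator_mean by (auto simp: estimators_def has_bochner_integral_iff)
qed

text \<open>By \<open>ln (1 + x) \<le> x\<close> the squared norm is at most
  \<open>2 * sqrt n\<close>, hence at most \<open>2 * n\<close>, on the whole parameter space. This
  gives \<open>2 * n + 4 * (2 * n)\<close>.\<close>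

lemma worst_mse_quadratic_estimator:
  assumes "1 \<le> n" "1 \<le> s"
  shows "worst_mse n s (quadratic_estimator n) \<le> ennreal (10 * real n)"
  unfolding worst_mse_def
proof (rule SUP_least)
  fix \<theta> assume "\<theta> \<in> param_space n s"
  then have "sq_norm n \<theta> \<le> 2 * real s * ln (1 + sqrt n / s)"
    by (simp add: param_space_def)
  also have "\<dots> \<le> 2 * real s * (sqrt n / s)"
    by (intro mult_left_mono ln_add_one_self_le_self) auto
  also have "\<dots> = 2 * sqrt n"
    using assms by simp
  also have "\<dots> \<le> 2 * real n"
    using assms real_le_lsqrt[of n n] by (simp add: power2_eq_square real_le_lsqrt)
  finally have "2 * real n + 4 * sq_norm n \<theta> \<le> 10 * real n" by simp
  moreover have "mse n (quadratic_estimator n) \<theta> = ennreal (2 * n + 4 * sq_norm n \<theta>)"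
    unfolding mse_def using quadratic_estimator_error(2)[of n \<theta>]
    by (subst nn_integral_eq_integral) (auto simp: has_bochner_integral_iff)
  ultimately show "mse n (quadratic_estimator n) \<theta> \<le> ennreal (10 * real n)"
    by (simp add: ennreal_leI)
qed

section \<open>Constant estimators\<close>

lemma const_in_estimators: "(\<lambda>_. c) \<in> estimators n s"
proof -
  have "integrable (gauss_model n \<theta>) (\<lambda>_. c)" for \<theta>
  proof -
    interpret prob_space "gauss_model n \<theta>" by (rule prob_space_gauss_model)
    show ?thesis by simp
  qed
  moreover have "(\<lambda>_. c) \<in> borel_measurable (\<Pi>\<^sub>M i\<in>{1..n}. borel)"
    by (rule borel_measurable_const)
  ultimately show ?thesis unfolding estimators_def by blast
qed

lemma worst_var_const: "worst_var n s (\<lambda>_. c) = 0"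
proof -
  have "vari n (\<lambda>_. c) \<theta> = 0" for \<theta>
  proof -
    interpret prob_space "gauss_model n \<theta>" by (rule prob_space_gauss_model)
    show ?thesis by (simp add: vari_def mean_def prob_space)
  qed
  then show ?thesis
    unfolding worst_var_def by (intro antisym SUP_least) auto
qed

text \<open>The risk of 0 is the square of the functional. For \<open>z = sqrt n / s\<close> at
  least 2, \<open>1 + z \<le> z\<^sup>2\<close> turns the logarithm in the parameter space into that
  of the rate.\<close>

lemma worst_mse_zero_estimator:
  assumes "1 \<le> n" "1 \<le> s" "2 * real s \<le> sqrt n"
  shows "worst_mse n s (\<lambda>_. 0) \<le> ennreal (4 * ((real s)\<^sup>2 * (ln (n / (real s)\<^sup>2))\<^sup>2))"
  unfolding worst_mse_def
proof (rule SUP_least)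
  fix \<theta> assume "\<theta> \<in> param_space n s"
  interpret prob_space "gauss_model n \<theta>" by (rule prob_space_gauss_model)
  have x: "2 \<le> sqrt n / s" using assms by (simp add: field_simps)
  have "sq_norm n \<theta> \<le> 2 * real s * ln (1 + sqrt n / s)"
    using \<open>\<theta> \<in> _\<close> by (simp add: param_space_def)
  also have "\<dots> \<le> 2 * real s * ln ((sqrt n / s)\<^sup>2)"
  proof -
    have "1 + z \<le> z\<^sup>2" if "2 \<le> z" for z :: real
      using that mult_right_mono[of 2 z z] unfolding power2_eq_square by linarith
    then have "1 + sqrt n / s \<le> (sqrt n / s)\<^sup>2"
      using x by blast
    then show ?thesis
      using x by (intro mult_left_mono ln_mono) auto
  qed
  also have "(sqrt n / s)\<^sup>2 = n / (real s)\<^sup>2"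
    by (simp add: power_divide)
  finally have "(sq_norm n \<theta>)\<^sup>2 \<le> (2 * real s * ln (n / (real s)\<^sup>2))\<^sup>2"
    by (intro power_mono) (auto simp: sq_norm_def sum_nonneg)
  then show "mse n (\<lambda>_. 0) \<theta> \<le> ennreal (4 * ((real s)\<^sup>2 * (ln (n / (real s)\<^sup>2))\<^sup>2))"
    by (simp add: mse_def emeasure_space_1 ennreal_leI power_mult_distrib)
qed

section \<open>Choice of the spikes in the two regimes\<close>

text \<open>Rounding the block length down costs at most a factor 2, since the remainder is below
  \<open>s\<close>, hence below \<open>s * (n div s)\<close>.\<close>

lemma block_length_bounds:
  fixes n s :: nat
  assumes "1 \<le> s" "s \<le> n"
  shows "1 \<le> n div s" "s * (n div s) \<le> n" "real n \<le> 2 * s * real (n div s)"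
proof -
  show k: "1 \<le> n div s"
    using assms by (simp add: Suc_le_eq div_greater_zero_iff)
  show "s * (n div s) \<le> n" by simp
  have "n = s * (n div s) + n mod s" by simp
  also have "\<dots> \<le> s * (n div s) + s * 1"
    using assms by (intro add_left_mono) simp
  also have "\<dots> \<le> s * (n div s) + s * (n div s)"
    by (intro add_left_mono mult_le_mono2 k)
  finally have "n \<le> 2 * s * (n div s)" by simp
  then have "real n \<le> real (2 * s * (n div s))"
    by (rule of_nat_mono)
  then show "real n \<le> 2 * s * real (n div s)" by simp
qed

lemma log_rate_le_bias_plus_risk:
  fixes n s :: nat
  assumes T: "T \<in> estimators n s"
    and s: "1 \<le> s" "s \<le> n" "2 * real s \<le> sqrt n"
    and b: "worst_sq_bias n s T \<le> ennreal (b\<^sup>2)" "0 \<le> b"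
    and m: "worst_mse n s T \<le> ennreal m" "0 \<le> m"
  shows "s * ln (n / (real s)\<^sup>2) / 2 \<le> 2 * b + sqrt (m * (exp (2 * (s / sqrt n)) - 1))"
proof -
  define k where "k = n div s"
  define z where "z = sqrt n / s"
  \<comment> \<open>Then \<open>exp (\<rho>\<^sup>2) = z\<close>, and the functional at the spikes,
    \<open>s * ln z\<close>, is half of \<open>s * ln (n / s\<^sup>2)\<close>.\<close>
  define \<rho> where "\<rho> = sqrt (ln z)"
  have z: "2 \<le> z" using s by (simp add: z_def field_simps)
  have \<rho>: "\<rho>\<^sup>2 = ln z" using z by (simp add: \<rho>_def)
  have "n / (real s)\<^sup>2 = z\<^sup>2" by (simp add: z_def power_divide)
  then have ln_z: "ln (n / (real s)\<^sup>2) / 2 = ln z" using z by (simp add: ln_realpow)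
  note k = block_length_bounds[OF s(1,2), folded k_def]
  have "s * ln z \<le> 2 * s * ln (1 + z)"
  proof -
    have "ln z \<le> ln (1 + z)" "0 \<le> ln (1 + z)" using z by auto
    then have "ln z \<le> 2 * ln (1 + z)" by linarith
    then show ?thesis using mult_left_mono[of "ln z" "2 * ln (1 + z)" "real s"] by simp
  qed
  then have "s * \<rho>\<^sup>2 \<le> 2 * b + sqrt (m * (exp (s * (exp (\<rho>\<^sup>2) - 1) / k) - 1))"
    using T s k b m by (intro sq_norm_le_bias_plus_risk[where s = s]) (auto simp: \<rho> z_def)
  also have "\<dots> \<le> 2 * b + sqrt (m * (exp (2 * (s / sqrt n)) - 1))"
  proof -
    have n: "real n > 0" using s by simp
    \<comment> \<open>The exponent of the divergence is thus at most \<open>sqrt n / k\<close>, and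
      \<open>n \<le> 2 * s * k\<close> bounds this by \<open>2 * s / sqrt n\<close>.\<close>
    have "s * (z - 1) \<le> sqrt n"
      using s by (simp add: z_def algebra_simps)
    then have "s * (z - 1) / k \<le> sqrt n / k"
      by (intro divide_right_mono) auto
    also have "\<dots> \<le> 2 * (s / sqrt n)"
      using n k by (simp add: field_simps)
    finally show ?thesis
      using m z by (simp add: \<rho> mult_left_mono)
  qed
  finally show ?thesis
    using ln_z by (simp add: \<rho> mult.commute)
qed

text \<open>Spikes of height 1, at most \<open>sqrt n\<close> of them, keep the divergence bounded
  by a constant. Taking the root of the risk bound for \<open>b\<close> leaves an inequality in the
  risk alone; the 2 in the constant comes from the bias, \<open>exp 4\<close> from the
  divergence.\<close>

lemma min_sqrt_le_risk:
  fixes n s :: nat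
  assumes T: "T \<in> estimators n s" and s: "1 \<le> s" "s \<le> n"
    and m: "worst_mse n s T \<le> ennreal m" "0 \<le> m"
  defines "s' \<equiv> min s (nat \<lfloor>sqrt n\<rfloor>)"
  shows "s' \<le> (2 + exp 4) * sqrt m"
proof -
  define k where "k = n div s'"
  have s': "1 \<le> s'" "s' \<le> s" "real s' \<le> sqrt n" "s' \<le> n"
  proof -
    have "real (nat \<lfloor>sqrt n\<rfloor>) \<le> sqrt n" "1 \<le> nat \<lfloor>sqrt n\<rfloor>"
      using s by (auto simp: le_nat_floor)
    then show "1 \<le> s'" "s' \<le> s" "real s' \<le> sqrt n" "s' \<le> n"
      using s unfolding s'_def by linarith+
  qed
  note k = block_length_bounds[OF s'(1,4), folded k_def]
  define y where "y = sqrt n / s"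
  have y: "0 < y" using s by (simp add: y_def)
  have "real s' * 1\<^sup>2 \<le> 2 * real s * ln (1 + y)"
  proof -
    \<comment> \<open>The ratio \<open>y\<close> may be small or large, so the spikes are fitted
      into the parameter space through
      \<open>min 1 y \<le> 2 * y / (1 + y) \<le> 2 * ln (1 + y)\<close>.\<close>
    have "ln (1 / (1 + y)) \<le> 1 / (1 + y) - 1"
      using y by (intro ln_le_minus_one) auto
    then have ln_ge: "y / (1 + y) \<le> ln (1 + y)"
      using y by (simp add: ln_div field_simps)
    have "s' \<le> s * min 1 y"
      using s s' by (auto simp: y_def min_def)
    also have "\<dots> \<le> s * (2 * (y / (1 + y)))"
      using y by (intro mult_left_mono) (auto simp: min_def field_simps)
    also have "\<dots> \<le> s * (2 * ln (1 + y))"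
      using ln_ge by (intro mult_left_mono) auto
    finally show ?thesis by simp
  qed
  moreover define b where "b = sqrt m"
  have "worst_sq_bias n s T \<le> ennreal (b\<^sup>2)"
    using worst_sq_bias_le_worst_mse[OF T] m by (simp add: b_def)
  ultimately have "real s' * 1\<^sup>2 \<le> 2 * b + sqrt (m * (exp (s' * (exp (1\<^sup>2) - 1) / k) - 1))"
    using T s s' k m by (intro sq_norm_le_bias_plus_risk[where s = s]) (auto simp: y_def b_def)
  also have "\<dots> \<le> 2 * b + sqrt (m * (exp 4)\<^sup>2)"
  proof -
    have n: "real n > 0" using s by simp
    \<comment> \<open>From \<open>s' * s' \<le> n \<le> 2 * s' * k\<close> follows
      \<open>s' \<le> 2 * k\<close>; with \<open>exp 1 - 1 \<le> 2\<close> the exponent is at most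
      4.\<close>
    have "real s' * real s' \<le> sqrt n * sqrt n"
      using s' by (intro mult_mono) auto
    then have "real s' * real s' \<le> 2 * s' * real k"
      using k(3) by simp
    then have sk: "s' \<le> 2 * real k"
      using s' by simp
    have "exp 1 - 1 \<le> (2::real)" using exp_le by simp
    then have "s' * (exp 1 - 1) / k \<le> (2 * real k) * 2 / k"
      using sk k(1) by (intro divide_right_mono mult_mono) auto
    also have "\<dots> = 4" using k(1) by simp
    finally have "exp (s' * (exp 1 - 1) / k) \<le> exp 4" by simp
    also have "exp 4 \<le> (exp (4::real))\<^sup>2" by (rule self_le_power) auto
    finally show ?thesis
      using m by (intro add_left_mono real_sqrt_le_mono mult_left_mono) auto
  qed
  also have "\<dots> = (2 + exp 4) * sqrt m"
    using m by (simp add: real_sqrt_mult b_def algebra_simps)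
  finally show ?thesis by simp
qed

section \<open>Asymptotic orders of the minimax risk and the bias\<close>

lemma minimax_risk_le: "T \<in> estimators n s \<Longrightarrow> minimax_risk n s \<le> worst_mse n s T"
  unfolding minimax_risk_def by (rule INF_lower)

text \<open>Reduces a lower bound in \<open>ennreal\<close> to a real inequality for estimators of
  finite worst-case risk. Dividing by \<open>c\<close> first gives a bound that passes directly to
  the infimum.\<close>

lemma le_minimax_risk:
  assumes "\<And>T m. T \<in> estimators n s \<Longrightarrow> worst_mse n s T \<le> ennreal m \<Longrightarrow> 0 \<le> m \<Longrightarrow> a \<le> c * m"
    and "0 < c"
  shows "ennreal a \<le> ennreal c * minimax_risk n s"
proof -
  have "ennreal (a / c) \<le> worst_mse n s T" if "T \<in> estimators n s" for T
  proof (cases "worst_mse n s T")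
    case (real m)
    then have "a \<le> c * m" using assms(1)[OF that, of m] by simp
    then have "a / c \<le> m"
      using \<open>0 < c\<close> by (simp add: pos_divide_le_eq mult.commute)
    then show ?thesis
      unfolding real by (rule ennreal_leI)
  qed simp
  then have "ennreal (a / c) \<le> minimax_risk n s"
    unfolding minimax_risk_def by (rule INF_greatest)
  then have "ennreal c * ennreal (a / c) \<le> ennreal c * minimax_risk n s"
    by (intro mult_left_mono) auto
  also have "ennreal c * ennreal (a / c) = ennreal a"
    using \<open>0 < c\<close> by (subst ennreal_mult'[symmetric]) auto
  finally show ?thesis .
qed

lemma lesssimI:
  "0 < C \<Longrightarrow> \<forall>\<^sub>F n in sequentially. a n \<le> ennreal C * b n \<Longrightarrow> lesssim a b"
  unfolding lesssim_def by blast

text \<open>One inequality, \<open>log_rate_le_bias_plus_risk\<close>, serves twice. Bounding the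
  bias by the risk gives the minimax lower bound. For a rate optimal estimator the risk term is
  multiplied by a factor tending to 0, so the bias must carry the rate.\<close>

lemma sparse_regime:
  fixes s :: "nat \<Rightarrow> nat"
  assumes s_bounds: "\<And>n. n \<ge> 1 \<Longrightarrow> 1 \<le> s n \<and> s n \<le> n"
    and lim: "(\<lambda>n. real (s n) / sqrt (real n)) \<longlonglongrightarrow> 0"
  defines "r \<equiv> \<lambda>n. (real (s n))\<^sup>2 * (ln (real n / (real (s n))\<^sup>2))\<^sup>2"
  shows "same_order (\<lambda>n. minimax_risk n (s n)) (\<lambda>n. ennreal (r n))"
    and "rate_optimal s T \<Longrightarrow> same_order (\<lambda>n. worst_sq_bias n (s n) (T n)) (\<lambda>n. ennreal (r n))"
    and "rate_optimal s (\<lambda>_ _. 0)"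
proof -
  define R where "R n = real (s n) * ln (real n / (real (s n))\<^sup>2) / 2" for n
  have r_R: "r n = 4 * (R n)\<^sup>2" "0 \<le> r n" for n
    by (simp_all add: r_def R_def power_mult_distrib power_divide)
  \<comment> \<open>An upper bound for the chi-square divergence; it tends to 0 because
    \<open>s n / sqrt n\<close> does.\<close>
  define q where "q n = exp (2 * (real (s n) / sqrt (real n))) - 1" for n
  have q_nonneg: "0 \<le> q n" for n by (simp add: q_def)
  have "q \<longlonglongrightarrow> exp (2 * 0) - 1"
    unfolding q_def by (intro tendsto_intros lim)
  then have q: "\<forall>\<^sub>F n in sequentially. q n < e" if "0 < e" for e
    using order_tendstoD(2)[of q 0 sequentially e] that by simp
  have "\<forall>\<^sub>F n in sequentially. real (s n) / sqrt (real n) < 1 / 2"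
    using order_tendstoD(2)[OF lim, of "1 / 2"] by simp
  then have ev: "\<forall>\<^sub>F n in sequentially.
      1 \<le> n \<and> 1 \<le> s n \<and> s n \<le> n \<and> 2 * real (s n) \<le> sqrt n \<and> 0 \<le> R n"
    using eventually_ge_at_top[of 1]
  proof eventually_elim
    case (elim n)
    have s: "1 \<le> s n" "s n \<le> n" "2 * real (s n) \<le> sqrt n"
      using s_bounds elim by (auto simp: field_simps)
    have "(real (s n))\<^sup>2 \<le> (sqrt n)\<^sup>2"
      using s by (intro power_mono) auto
    then have "0 \<le> R n"
      using s by (simp add: R_def)
    then show ?case using s elim by simp
  qed
  have upper0: "\<forall>\<^sub>F n in sequentially. worst_mse n (s n) (\<lambda>_. 0) \<le> ennreal 4 * ennreal (r n)"
    using ev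
  proof eventually_elim
    case (elim n)
    then show ?case
      using worst_mse_zero_estimator[of n "s n"] by (simp add: r_def ennreal_mult)
  qed
  then have upper: "\<forall>\<^sub>F n in sequentially. minimax_risk n (s n) \<le> ennreal 4 * ennreal (r n)"
    by eventually_elim (rule order_trans[OF minimax_risk_le[OF const_in_estimators]])
  \<comment> \<open>Here \<open>q n < 1\<close> suffices: then \<open>R n \<le> 3 * sqrt m\<close>,
    and \<open>r n\<close>, which is 4 times the square of \<open>R n\<close>, is at most
    \<open>36 * m\<close>.\<close>
  have lower: "\<forall>\<^sub>F n in sequentially. ennreal (r n) \<le> ennreal 36 * minimax_risk n (s n)"
    using ev q[OF zero_less_one]
  proof eventually_elim
    case (elim n)
    show ?case
    proof (rule le_minimax_risk)
      fix T m assume T: "T \<in> estimators n (s n)" and m: "worst_mse n (s n) T \<le> ennreal m" "0 \<le> m"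
      have "worst_sq_bias n (s n) T \<le> ennreal ((sqrt m)\<^sup>2)"
        using worst_sq_bias_le_worst_mse[OF T] m by simp
      then have "R n \<le> 2 * sqrt m + sqrt (m * q n)"
        unfolding R_def q_def using elim m T by (intro log_rate_le_bias_plus_risk) auto
      also have "\<dots> \<le> 2 * sqrt m + sqrt (m * 1)"
        using elim m by (intro add_left_mono real_sqrt_le_mono mult_left_mono) auto
      finally have "R n \<le> 3 * sqrt m" by simp
      then have "(R n)\<^sup>2 \<le> (3 * sqrt m)\<^sup>2"
        using elim by (intro power_mono) auto
      then show "r n \<le> 36 * m"
        using m by (simp add: r_R power_mult_distrib)
    qed simp
  qed
  show "same_order (\<lambda>n. worst_sq_bias n (s n) (T n)) (\<lambda>n. ennreal (r n))"
    if T: "rate_optimal s T"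
  proof -
    obtain C where "0 < C"
      and C: "\<forall>\<^sub>F n in sequentially. worst_mse n (s n) (T n) \<le> ennreal C * minimax_risk n (s n)"
      using T by (auto simp: rate_optimal_def lesssim_def)
    have T_est: "T n \<in> estimators n (s n)" if "1 \<le> n" for n
      using T that by (simp add: rate_optimal_def estimator_seq_def)
    have risk: "\<forall>\<^sub>F n in sequentially. worst_mse n (s n) (T n) \<le> ennreal (4 * C * r n)"
      using C upper
    proof eventually_elim
      case (elim n)
      note elim(1)
      also have "ennreal C * minimax_risk n (s n) \<le> ennreal C * (ennreal 4 * ennreal (r n))"
        by (intro mult_left_mono elim) simp
      also have "\<dots> = ennreal (4 * C * r n)"
        using \<open>0 < C\<close> r_R(2)[of n] by (simp add: ennreal_mult mult_ac)
      finally show ?case .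
    qed
    have upper_bias: "\<forall>\<^sub>F n in sequentially. worst_sq_bias n (s n) (T n) \<le> ennreal (4 * C) * ennreal (r n)"
      using ev risk
    proof eventually_elim
      case (elim n)
      then have "worst_sq_bias n (s n) (T n) \<le> ennreal (4 * C * r n)"
        using worst_sq_bias_le_worst_mse[OF T_est[of n]] by auto
      then show ?case
        using \<open>0 < C\<close> r_R(2)[of n] by (simp add: ennreal_mult)
    qed
    \<comment> \<open>With this threshold the risk term \<open>sqrt (4 * C * r n * q n)\<close> is
      at most \<open>R n / 2\<close> and is absorbed on the left.\<close>
    have q': "\<forall>\<^sub>F n in sequentially. q n < 1 / (64 * C)"
      using \<open>0 < C\<close> by (intro q) simp
    have lower_bias: "\<forall>\<^sub>F n in sequentially. ennreal (r n) \<le> ennreal 64 * worst_sq_bias n (s n) (T n)"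
      using ev risk q'
    proof eventually_elim
      case (elim n)
      have "worst_sq_bias n (s n) (T n) \<le> ennreal (4 * C * r n)"
        using worst_sq_bias_le_worst_mse[OF T_est[of n]] elim by auto
      \<comment> \<open>The bias is finite because the risk bounds it, so the real-valued inequality
        can be applied with \<open>b = sqrt B\<close>.\<close>
      then obtain B where B: "worst_sq_bias n (s n) (T n) = ennreal B" "0 \<le> B"
        by (cases "worst_sq_bias n (s n) (T n)") (auto simp: top_unique)
      have "R n \<le> 2 * sqrt B + sqrt (4 * C * r n * q n)"
        unfolding R_def q_def using elim T_est[of n] B \<open>0 < C\<close> r_R(2)[of n]
        by (intro log_rate_le_bias_plus_risk) auto
      also have "\<dots> \<le> 2 * sqrt B + sqrt (4 * C * r n * (1 / (64 * C)))"
        using elim \<open>0 < C\<close> r_R(2)[of n] by (intro add_left_mono real_sqrt_le_mono mult_left_mono) auto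
      also have "4 * C * r n * (1 / (64 * C)) = (R n / 2)\<^sup>2"
        using \<open>0 < C\<close> by (simp add: r_R power_divide)
      also have "2 * sqrt B + sqrt ((R n / 2)\<^sup>2) = 2 * sqrt B + R n / 2"
        using elim by simp
      finally have "R n \<le> 4 * sqrt B" by simp
      then have "(R n)\<^sup>2 \<le> (4 * sqrt B)\<^sup>2"
        using elim by (intro power_mono) auto
      then have "r n \<le> 64 * B"
        using B by (simp add: r_R power_mult_distrib)
      then show ?case
        unfolding B(1) by (subst ennreal_mult[symmetric]) (use B in \<open>auto intro: ennreal_leI\<close>)
    qed
    show ?thesis
      unfolding same_order_def using \<open>0 < C\<close>
      by (intro conjI lesssimI[OF _ upper_bias] lesssimI[OF _ lower_bias]) auto
  qed
  \<comment> \<open>The constant is 4 from the upper bound for the zero estimator times 36 from the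
    minimax lower bound.\<close>
  have "\<forall>\<^sub>F n in sequentially. worst_mse n (s n) (\<lambda>_. 0) \<le> ennreal 144 * minimax_risk n (s n)"
    using upper0 lower
  proof eventually_elim
    case (elim n)
    note elim(1)
    also have "ennreal 4 * ennreal (r n) \<le> ennreal 4 * (ennreal 36 * minimax_risk n (s n))"
      by (intro mult_left_mono elim) simp
    also have "\<dots> = ennreal 144 * minimax_risk n (s n)"
      by (simp flip: ennreal_mult mult.assoc)
    finally show ?case .
  qed
  then have "lesssim (\<lambda>n. worst_mse n (s n) (\<lambda>_. 0)) (\<lambda>n. minimax_risk n (s n))"
    by (rule lesssimI[rotated]) simp
  then show "rate_optimal s (\<lambda>_ _. 0)"
    by (simp add: rate_optimal_def estimator_seq_def const_in_estimators)
  show "same_order (\<lambda>n. minimax_risk n (s n)) (\<lambda>n. ennreal (r n))"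
    unfolding same_order_def by (intro conjI lesssimI[OF _ upper] lesssimI[OF _ lower]) auto
qed

text \<open>The risk of the quadratic estimator is at most \<open>10 * n\<close>, so it remains to
  bound the minimax risk below by a multiple of \<open>n\<close>. Density of \<open>s\<close> makes
  the number of spikes in \<open>min_sqrt_le_risk\<close> of order \<open>sqrt n\<close>.\<close>

lemma dense_regime:
  fixes s :: "nat \<Rightarrow> nat"
  assumes s_bounds: "\<And>n. n \<ge> 1 \<Longrightarrow> 1 \<le> s n \<and> s n \<le> n"
    and dense: "lesssim (\<lambda>n. ennreal (sqrt (real n))) (\<lambda>n. ennreal (real (s n)))"
  shows "rate_optimal s quadratic_estimator"
proof -
  obtain C where "0 < C" and C: "\<forall>\<^sub>F n in sequentially. ennreal (sqrt n) \<le> ennreal C * ennreal (s n)"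
    using dense by (auto simp: lesssim_def)
  \<comment> \<open>\<open>max C 2\<close> covers both arguments of the minimum \<open>s'\<close>:
    \<open>sqrt n \<le> C * s n\<close> by assumption, and \<open>sqrt n\<close> is at most twice
    its floor since it is at least 1. The other factor comes from
    \<open>min_sqrt_le_risk\<close>.\<close>
  define D where "D = max C 2 * (2 + exp 4)"
  have "0 < D" unfolding D_def by (intro mult_pos_pos add_pos_pos) auto
  have "\<forall>\<^sub>F n in sequentially. worst_mse n (s n) (quadratic_estimator n) \<le> ennreal (10 * D\<^sup>2) * minimax_risk n (s n)"
    using C eventually_ge_at_top[of 1]
  proof eventually_elim
    case (elim n)
    have s: "1 \<le> s n" "s n \<le> n" using s_bounds elim by auto
    define s' where "s' = min (s n) (nat \<lfloor>sqrt n\<rfloor>)"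
    have "1 \<le> sqrt n" using elim by simp
    have "sqrt n \<le> C * s n"
      using elim \<open>0 < C\<close> by (simp flip: ennreal_mult)
    also have "\<dots> \<le> max C 2 * s n"
      by (intro mult_right_mono) auto
    finally have 1: "sqrt n \<le> max C 2 * s n" .
    have "sqrt n \<le> 2 * real (nat \<lfloor>sqrt n\<rfloor>)"
    proof -
      have "real (nat \<lfloor>sqrt n\<rfloor>) = of_int \<lfloor>sqrt n\<rfloor>" "1 \<le> \<lfloor>sqrt n\<rfloor>"
        using \<open>1 \<le> sqrt n\<close> by auto
      then show ?thesis by linarith
    qed
    also have "\<dots> \<le> max C 2 * real (nat \<lfloor>sqrt n\<rfloor>)"
      by (intro mult_right_mono) auto
    finally have s': "sqrt n \<le> max C 2 * s'"
      using 1 by (simp add: s'_def min_def)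
    have "ennreal (real n) \<le> ennreal (D\<^sup>2) * minimax_risk n (s n)"
    proof (rule le_minimax_risk)
      fix T m assume T: "T \<in> estimators n (s n)" and m: "worst_mse n (s n) T \<le> ennreal m" "0 \<le> m"
      have "s' \<le> (2 + exp 4) * sqrt m"
        using min_sqrt_le_risk[OF T s m] by (simp add: s'_def)
      then have "max C 2 * s' \<le> max C 2 * ((2 + exp 4) * sqrt m)"
        by (intro mult_left_mono) auto
      with s' have "sqrt n \<le> D * sqrt m"
        unfolding D_def mult.assoc by (rule order_trans)
      then have "(sqrt n)\<^sup>2 \<le> (D * sqrt m)\<^sup>2"
        by (intro power_mono) auto
      then show "real n \<le> D\<^sup>2 * m"
        using m by (simp add: power_mult_distrib)
    qed (use \<open>0 < D\<close> in simp)
    then have "ennreal 10 * ennreal (real n) \<le> ennreal 10 * (ennreal (D\<^sup>2) * minimax_risk n (s n))"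
      by (intro mult_left_mono) auto
    then show ?case
      using worst_mse_quadratic_estimator[OF elim(2) s(1)]
      by (simp add: ennreal_mult mult.assoc)
  qed
  then have "lesssim (\<lambda>n. worst_mse n (s n) (quadratic_estimator n)) (\<lambda>n. minimax_risk n (s n))"
    by (rule lesssimI[rotated]) (use \<open>0 < D\<close> in simp)
  then show ?thesis
    by (simp add: rate_optimal_def estimator_seq_def quadratic_estimator_in_estimators)
qed

theorem theorem6p2:
  fixes s :: "nat \<Rightarrow> nat"
  assumes "\<And>n. n \<ge> 1 \<Longrightarrow> 1 \<le> s n \<and> s n \<le> n"
  shows "((\<lambda>n. real (s n) / sqrt (real n)) \<longlonglongrightarrow> 0 \<longrightarrow>
            same_order (\<lambda>n. minimax_risk n (s n))
              (\<lambda>n. ennreal ((real (s n))\<^sup>2 * (ln (real n / (real (s n))\<^sup>2))\<^sup>2)) \<and>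
            (\<forall>T. rate_optimal s T \<longrightarrow>
              same_order (\<lambda>n. worst_sq_bias n (s n) (T n))
                (\<lambda>n. ennreal ((real (s n))\<^sup>2 * (ln (real n / (real (s n))\<^sup>2))\<^sup>2))) \<and>
            (\<forall>\<delta>::real. 0 < \<delta> \<and> \<delta> < 1/2 \<and>
                (\<forall>\<^sub>F n in sequentially. real (s n) \<le> real n powr (1/2 - \<delta>)) \<longrightarrow>
              (\<exists>T. rate_optimal s T \<and>
                lesssim (\<lambda>n. worst_var n (s n) (T n))
                  (\<lambda>n. ennreal (real (s n) * ln (real n / (real (s n))\<^sup>2)))))) \<and>
         (lesssim (\<lambda>n. ennreal (sqrt (real n))) (\<lambda>n. ennreal (real (s n))) \<longrightarrow>
            (\<exists>T. rate_optimal s T \<and> unbiased s T))"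
proof -
  \<comment> \<open>The zero estimator, rate optimal in the sparse regime, is the witness for the
    variance claim: its variance is 0 and so below any bound.\<close>
  have "lesssim (\<lambda>n. worst_var n (s n) (\<lambda>_. 0)) a" for a
    by (rule lesssimI[of 1]) (simp_all add: worst_var_const)
  moreover have "unbiased s quadratic_estimator"
    using quadratic_estimator_mean
    by (simp add: unbiased_def mean_def has_bochner_integral_integral_eq)
  ultimately show ?thesis
    by (intro conjI impI allI exI[of _ "\<lambda>_ _. 0"] exI[of _ quadratic_estimator]
        sparse_regime dense_regime assms)
qed

end
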